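(* Let $m$ be a positive integer. Then there exists $C_m>0$ such that $$\sum_{|\alpha|=m}\bigl\|x^\alpha e^{t\Delta}\varphi-e^{t\Delta}x^\alpha\varphi\bigr\|_1\le C_m\left\{t^{\frac12}\bigl\||x|^{m-1}\varphi\bigr\|_1+\left(t^{\frac12}+t^{\frac m2}\right)\|\varphi\|_1\right\}$$ holds for any $\varphi\in L^1_m(\mathbb{R}^n)$ and any $t>0$, where the sum is over $\alpha\in\mathbb{Z}_{\ge0}^n$ with $|\alpha|=m$.
   Context: $n\ge1$ is an integer and $\|\cdot\|_1$ is the $L^1(\mathbb{R}^n)$ norm. $e^{t\Delta}\varphi=G_t*\varphi$ for $t>0$, with $G_t(x)=(4\pi t)^{-n/2}\exp(-|x|^2/(4t))$. $x^\alpha\varphi$ denotes the function $x\mapsto x^\alpha\varphi(x)$, so $e^{t\Delta}x^\alpha\varphi=e^{t\Delta}(x^\alpha\varphi)$; similarly $|x|^{m-1}\varphi$ is $x\mapsto|x|^{m-1}\varphi(x)$. $L^1_m(\mathbb{R}^n)=\{\varphi\in L^1(\mathbb{R}^n): x^\alpha\varphi\in L^1(\mathbb{R}^n)\text{ for all }\alpha\in\mathbb{Z}_{\ge0}^n\text{ with }|\alpha|\le m\}$. *)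

theory Defs
  imports "HOL-Analysis.Analysis"
begin

text \<open>
  Multi-indices in dimension \<open>CARD('n)\<close> are functions \<open>'n \<Rightarrow> nat\<close>.
\<close>

definition mi_order :: "('n::finite \<Rightarrow> nat) \<Rightarrow> nat" where
  "mi_order \<alpha> = (\<Sum>i\<in>UNIV. \<alpha> i)"

definition mi_pow :: "real ^ 'n \<Rightarrow> ('n::finite \<Rightarrow> nat) \<Rightarrow> real" where
  "mi_pow x \<alpha> = (\<Prod>i\<in>UNIV. (x $ i) ^ \<alpha> i)"

text \<open>
  The next fact guarantees that sums over the multi-indices of a given order are genuine finite sums.
\<close>

lemma finite_mi_order_eq: "finite {\<alpha> :: 'n::finite \<Rightarrow> nat. mi_order \<alpha> = m}"
proof (rule finite_subset)
  show "{\<alpha> :: 'n \<Rightarrow> nat. mi_order \<alpha> = m} \<subseteq> (UNIV \<rightarrow>\<^sub>E {..m})"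
    by (auto simp: mi_order_def intro: member_le_sum)
  show "finite ((UNIV :: 'n set) \<rightarrow>\<^sub>E {..m})"
    by (intro finite_PiE) auto
qed

text \<open>
  The \<open>L\<^sup>1\<close> norm takes values in \<open>[0, \<infinity>]\<close>, so that a finite bound on it is meaningful also
  for functions not known to be integrable in advance.
\<close>

definition L1_norm :: "(real ^ 'n::finite \<Rightarrow> complex) \<Rightarrow> ennreal" where
  "L1_norm f = (\<integral>\<^sup>+ x. ennreal (norm (f x)) \<partial>lebesgue)"

definition L1_weighted :: "nat \<Rightarrow> (real ^ 'n::finite \<Rightarrow> complex) set" where
  "L1_weighted m = {\<phi>. integrable lebesgue \<phi> \<and>
     (\<forall>\<alpha>. mi_order \<alpha> \<le> m \<longrightarrow> integrable lebesgue (\<lambda>x. mi_pow x \<alpha> *\<^sub>R \<phi> x))}"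

definition heat_kernel :: "real \<Rightarrow> real ^ 'n::finite \<Rightarrow> real" where
  "heat_kernel t x = (4 * pi * t) powr (- real CARD('n) / 2) * exp (- (norm x)\<^sup>2 / (4 * t))"

definition heat_semigroup ::
    "real \<Rightarrow> (real ^ 'n::finite \<Rightarrow> complex) \<Rightarrow> real ^ 'n \<Rightarrow> complex" where
  "heat_semigroup t \<phi> x = (LINT y|lebesgue. heat_kernel t (x - y) *\<^sub>R \<phi> y)"

end

theory Submission
  imports Defs "HOL-Probability.Distributions"
begin

text \<open>
  The commutator is the integral operator with kernel \<open>(x\<^sup>\<alpha> - y\<^sup>\<alpha>) G\<^sub>t(x - y)\<close>. Since
  \<open>\<bar>x\<^sup>\<alpha> - y\<^sup>\<alpha>\<bar> \<le> m 2\<^sup>m\<^sup>-\<^sup>1 (\<bar>x - y\<bar> \<bar>y\<bar>\<^sup>m\<^sup>-\<^sup>1 + \<bar>x - y\<bar>\<^sup>m)\<close>, it is dominated by the convolutions of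
  \<open>\<bar>z\<bar> G\<^sub>t\<close> with \<open>\<bar>y\<bar>\<^sup>m\<^sup>-\<^sup>1 \<bar>\<phi>\<bar>\<close> and of \<open>\<bar>z\<bar>\<^sup>m G\<^sub>t\<close> with \<open>\<bar>\<phi>\<bar>\<close>. By Tonelli it remains to observe that the
  \<open>k\<close>-th absolute moment of \<open>G\<^sub>t\<close> is of order at most \<open>t\<close> to the power \<open>k / 2\<close>.
\<close>

section \<open>Differences of monomials\<close>

lemma mi_pow_scaleR: "mi_pow (c *\<^sub>R x) \<alpha> = c ^ mi_order \<alpha> * mi_pow x \<alpha>"
  by (simp add: mi_pow_def mi_order_def power_mult_distrib prod.distrib power_sum)

text \<open>On the unit ball every factor of either monomial has modulus at most 1, so a difference
  of products is bounded by the sum of the differences of the factors. Each power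
  \<open>s ^ \<alpha> i\<close> is Lipschitz on [-1, 1] with constant \<open>\<alpha> i\<close>, and
  these constants add up to the order.\<close>

lemma abs_mi_pow_diff_le_unit:
  fixes x y :: "real ^ 'n::finite"
  assumes "norm x \<le> 1" "norm y \<le> 1"
  shows "\<bar>mi_pow x \<alpha> - mi_pow y \<alpha>\<bar> \<le> mi_order \<alpha> * norm (x - y)"
proof -
  have le1: "\<bar>x $ i\<bar> \<le> 1" "\<bar>y $ i\<bar> \<le> 1" for i
    using component_le_norm_cart[of x i] component_le_norm_cart[of y i] assms by linarith+
  have "\<bar>mi_pow x \<alpha> - mi_pow y \<alpha>\<bar> \<le> (\<Sum>i\<in>UNIV. \<bar>(x $ i) ^ \<alpha> i - (y $ i) ^ \<alpha> i\<bar>)"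
    unfolding mi_pow_def real_norm_def[symmetric]
    by (rule norm_prod_diff) (auto simp: power_abs intro!: power_le_one le1)
  also have "\<dots> \<le> (\<Sum>i\<in>UNIV. \<alpha> i * norm (x - y))"
  proof (rule sum_mono)
    fix i
    have "\<bar>(x $ i) ^ \<alpha> i - (y $ i) ^ \<alpha> i\<bar> \<le> \<alpha> i * \<bar>x $ i - y $ i\<bar>"
      using norm_power_diff[of "x $ i" "y $ i" "\<alpha> i"] le1 by simp
    also have "\<dots> \<le> \<alpha> i * norm (x - y)"
      using component_le_norm_cart[of "x - y" i] by (intro mult_left_mono) auto
    finally show "\<bar>(x $ i) ^ \<alpha> i - (y $ i) ^ \<alpha> i\<bar> \<le> \<alpha> i * norm (x - y)" .
  qed
  finally show ?thesis
    by (simp add: mi_order_def sum_distrib_right)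
qed

text \<open>Monomials of order \<open>m\<close> are homogeneous of degree \<open>m\<close>. Dividing
  both points by \<open>R = norm y + norm (x - y)\<close> moves them into the unit ball, and scaling
  the Lipschitz bound back yields the factor \<open>R ^ (m - 1)\<close>.\<close>

lemma abs_mi_pow_diff_le:
  fixes x y :: "real ^ 'n::finite"
  assumes "mi_order \<alpha> = m" "m \<ge> 1"
  shows "\<bar>mi_pow x \<alpha> - mi_pow y \<alpha>\<bar>
    \<le> real m * 2 ^ (m - 1) * (norm (x - y) * norm y ^ (m - 1) + norm (x - y) ^ m)"
proof -
  define R where "R = norm y + norm (x - y)"
  have "R \<ge> 0" "norm y \<le> R" "norm x \<le> R"
    using norm_triangle_ineq[of "x - y" y] by (auto simp: R_def)
  have "\<bar>mi_pow x \<alpha> - mi_pow y \<alpha>\<bar> \<le> m * norm (x - y) * R ^ (m - 1)"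
  \<comment> \<open>Rescaling requires \<open>R > 0\<close>; if \<open>R = 0\<close>, the two points
    coincide and the left side vanishes.\<close>
  proof (cases "R = 0")
    case True
    then have "x = y" by (simp add: R_def add_nonneg_eq_0_iff)
    with \<open>R \<ge> 0\<close> show ?thesis by simp
  next
    case False
    with \<open>R \<ge> 0\<close> have "R > 0" by simp
    define x' y' where "x' = x /\<^sub>R R" and "y' = y /\<^sub>R R"
    have xy: "x = R *\<^sub>R x'" "y = R *\<^sub>R y'"
      using \<open>R > 0\<close> by (auto simp: x'_def y'_def)
    have "norm x' \<le> 1" "norm y' \<le> 1"
      using \<open>R > 0\<close> \<open>norm x \<le> R\<close> \<open>norm y \<le> R\<close> by (auto simp: x'_def y'_def field_simps)
    then have *: "\<bar>mi_pow x' \<alpha> - mi_pow y' \<alpha>\<bar> \<le> m * norm (x' - y')"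
      using abs_mi_pow_diff_le_unit[of x' y' \<alpha>] assms by simp
    have "\<bar>mi_pow x \<alpha> - mi_pow y \<alpha>\<bar> = R ^ m * \<bar>mi_pow x' \<alpha> - mi_pow y' \<alpha>\<bar>"
      using \<open>R > 0\<close> assms(1) by (simp add: xy mi_pow_scaleR abs_mult flip: right_diff_distrib)
    also have "\<dots> \<le> R ^ m * (m * norm (x' - y'))"
      using * \<open>R > 0\<close> by (intro mult_left_mono) auto
    also have "\<dots> = m * norm (x - y) * R ^ (m - 1)"
      using \<open>R > 0\<close> \<open>m \<ge> 1\<close>
      by (cases m) (simp_all add: xy flip: scaleR_diff_right)
    finally show ?thesis .
  qed
  \<comment> \<open>A sum of two nonnegative numbers is at most twice the larger one, and a power of
    the larger one is at most the sum of both powers. This is the origin of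
    \<open>2 ^ (m - 1)\<close>.\<close>
  also have "R ^ (m - 1) \<le> (2 * max (norm y) (norm (x - y))) ^ (m - 1)"
    using \<open>R \<ge> 0\<close> by (intro power_mono) (auto simp: R_def)
  also have "\<dots> \<le> 2 ^ (m - 1) * (norm y ^ (m - 1) + norm (x - y) ^ (m - 1))"
    by (simp add: power_mult_distrib max_def)
  finally have "\<bar>mi_pow x \<alpha> - mi_pow y \<alpha>\<bar>
      \<le> m * norm (x - y) * (2 ^ (m - 1) * (norm y ^ (m - 1) + norm (x - y) ^ (m - 1)))"
    by (simp add: mult_left_mono)
  also have "\<dots> = real m * 2 ^ (m - 1) * (norm (x - y) * norm y ^ (m - 1) + norm (x - y) ^ m)"
    using \<open>m \<ge> 1\<close> by (cases m) (simp_all add: algebra_simps)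
  finally show ?thesis .
qed

section \<open>Mass and absolute moments of the heat kernel\<close>

lemma heat_kernel_nonneg: "0 \<le> heat_kernel t x"
  by (simp add: heat_kernel_def)

lemma borel_measurable_heat_kernel [measurable]: "heat_kernel t \<in> borel_measurable borel"
  unfolding heat_kernel_def[abs_def] by measurable

lemma heat_kernel_le:
  fixes x :: "real ^ 'n::finite"
  assumes "t > 0"
  shows "heat_kernel t x \<le> (4 * pi * t) powr (- real CARD('n) / 2)"
  using assms by (simp add: heat_kernel_def mult_le_cancel_left1)

text \<open>The kernel at time \<open>t\<close> is the joint density of independent centred normal
  coordinates of variance \<open>2 * t\<close>. The factorisation reduces its total mass to
  one-dimensional Gaussian integrals.\<close>

lemma heat_kernel_eq_prod_normal_density:
  fixes x :: "real ^ 'n::finite"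
  assumes "t > 0"
  shows "heat_kernel t x = (\<Prod>b\<in>Basis. normal_density 0 (sqrt (2 * t)) (x \<bullet> b))"
proof -
  have "(norm x)\<^sup>2 = (\<Sum>b\<in>Basis. (x \<bullet> b)\<^sup>2)"
    unfolding power2_norm_eq_inner by (subst euclidean_inner) (simp add: power2_eq_square)
  then have "exp (- (norm x)\<^sup>2 / (4 * t)) = (\<Prod>b\<in>Basis. exp (- (x \<bullet> b)\<^sup>2 / (4 * t)))"
    by (simp add: exp_sum[symmetric] sum_divide_distrib sum_negf)
  moreover have "(4 * pi * t) powr (- real CARD('n) / 2) = (1 / sqrt (4 * pi * t)) ^ CARD('n)"
  proof -
    have "(4 * pi * t) powr (- real CARD('n) / 2) = ((4 * pi * t) powr (- 1 / 2)) ^ CARD('n)"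
      using assms by (simp add: powr_powr flip: powr_realpow)
    also have "(4 * pi * t) powr (- 1 / 2) = 1 / sqrt (4 * pi * t)"
      using assms by (simp add: powr_minus_divide powr_half_sqrt)
    finally show ?thesis .
  qed
  ultimately show ?thesis
    using assms by (simp add: heat_kernel_def normal_density_def prod_dividef power_divide mult_ac)
qed

lemma nn_integral_heat_kernel:
  assumes "t > 0"
  shows "(\<integral>\<^sup>+ x. heat_kernel t (x :: real ^ 'n::finite) \<partial>lborel) = 1"
proof -
  have "(\<integral>\<^sup>+ x. normal_density 0 (sqrt (2 * t)) x \<partial>lborel) = 1"
    using assms by (simp add: nn_integral_eq_integral)
  moreover have "(\<integral>\<^sup>+ x. heat_kernel t (x :: real ^ 'n) \<partial>lborel)
      = (\<integral>\<^sup>+ x. (\<Prod>b\<in>Basis. ennreal (normal_density 0 (sqrt (2 * t)) ((x :: real ^ 'n) \<bullet> b))) \<partial>lborel)"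
    using assms by (simp add: heat_kernel_eq_prod_normal_density prod_ennreal)
  moreover have "\<dots> = (\<Prod>b\<in>(Basis :: (real ^ 'n) set). \<integral>\<^sup>+ x. normal_density 0 (sqrt (2 * t)) x \<partial>lborel)"
    by (rule nn_integral_lborel_prod) auto
  ultimately show ?thesis
    by simp
qed

text \<open>For \<open>k > 0\<close>, linearising the exponential gives
  \<open>s \<le> 8 * k * exp (s\<^sup>2 / (8 * k))\<close>, and the \<open>k\<close>-th power
  cancels the \<open>k\<close> in the exponent. The rate 1/8 is half the Gaussian rate 1/4 of the
  heat kernel in the variable \<open>s = norm x / sqrt t\<close>. For \<open>k = 0\<close> both
  powers equal 1.\<close>

lemma power_le_exp_square: "s ^ k \<le> (8 * real k) ^ k * exp (s\<^sup>2 / 8)" if "s \<ge> 0" for s :: real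
proof (cases "k = 0")
  case False
  have "2 * s \<le> 1 + s\<^sup>2"
    using zero_le_power2[of "s - 1"] by (simp add: power2_eq_square algebra_simps)
  then have "s \<le> 1 + s\<^sup>2"
    using \<open>s \<ge> 0\<close> by linarith
  also have "\<dots> \<le> 8 * real k * (1 + s\<^sup>2 / (8 * k))"
    using False by (simp add: field_simps)
  also have "\<dots> \<le> 8 * real k * exp (s\<^sup>2 / (8 * k))"
    by (intro mult_left_mono exp_ge_add_one_self) auto
  finally have "s ^ k \<le> (8 * real k * exp (s\<^sup>2 / (8 * k))) ^ k"
    using \<open>s \<ge> 0\<close> by (rule power_mono)
  also have "\<dots> = (8 * real k) ^ k * exp (s\<^sup>2 / 8)"
    using False by (simp add: power_mult_distrib flip: exp_of_nat_mult)
  finally show ?thesis .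
qed simp

text \<open>Half of the Gaussian decay absorbs the polynomial weight; the other half is again a heat
  kernel, at time \<open>2 * t\<close>.\<close>

lemma norm_power_heat_kernel_le:
  fixes x :: "real ^ 'n::finite"
  assumes "t > 0"
  shows "norm x ^ k * heat_kernel t x
    \<le> (8 * real k) ^ k * 2 powr (real CARD('n) / 2) * sqrt t ^ k * heat_kernel (2 * t) x"
proof -
  \<comment> \<open>Parabolic scaling: the natural variable at time \<open>t\<close> is
    \<open>norm x / sqrt t\<close>, which produces the power of \<open>sqrt t\<close>.\<close>
  have "(norm x / sqrt t) ^ k \<le> (8 * real k) ^ k * exp ((norm x / sqrt t)\<^sup>2 / 8)"
    using assms by (intro power_le_exp_square) simp
  then have "norm x ^ k \<le> (8 * real k) ^ k * sqrt t ^ k * exp ((norm x)\<^sup>2 / (8 * t))"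
    using assms by (simp add: power_divide field_simps)
  then have "norm x ^ k * heat_kernel t x
      \<le> (8 * real k) ^ k * sqrt t ^ k * exp ((norm x)\<^sup>2 / (8 * t)) * heat_kernel t x"
    by (intro mult_right_mono heat_kernel_nonneg)
  \<comment> \<open>Halving the decay rate doubles the time; the factor
    \<open>2 powr (n / 2)\<close>, with \<open>n\<close> the dimension, is the ratio of the
    normalising constants at times \<open>t\<close> and \<open>2 * t\<close>.\<close>
  moreover have "exp ((norm x)\<^sup>2 / (8 * t)) * heat_kernel t x
      = 2 powr (real CARD('n) / 2) * heat_kernel (2 * t) x"
  proof -
    have "(4 * pi * (2 * t)) powr (- real CARD('n) / 2)
        = 2 powr (- real CARD('n) / 2) * (4 * pi * t) powr (- real CARD('n) / 2)"
      using assms by (subst powr_mult[symmetric]) (auto simp: mult_ac)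
    moreover have "exp ((norm x)\<^sup>2 / (8 * t)) * exp (- (norm x)\<^sup>2 / (4 * t))
        = exp (- (norm x)\<^sup>2 / (4 * (2 * t)))"
      using assms by (simp add: field_simps flip: exp_add)
    moreover have "2 powr (real CARD('n) / 2) * 2 powr (- real CARD('n) / 2) = 1"
      by (simp flip: powr_add)
    ultimately show ?thesis
      by (simp add: heat_kernel_def mult_ac)
  qed
  ultimately show ?thesis
    by (simp only: mult.assoc mult.left_commute)
qed

lemma nn_integral_norm_power_heat_kernel_le:
  assumes "t > 0"
  shows "(\<integral>\<^sup>+ x. norm x ^ k * heat_kernel t (x :: real ^ 'n::finite) \<partial>lborel)
    \<le> ennreal ((8 * real k) ^ k * 2 powr (real CARD('n) / 2) * sqrt t ^ k)"
proof -
  define c where "c = (8 * real k) ^ k * 2 powr (real CARD('n) / 2) * sqrt t ^ k"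
  have "c \<ge> 0"
    using assms by (simp add: c_def)
  have "(\<integral>\<^sup>+ x. norm x ^ k * heat_kernel t (x :: real ^ 'n) \<partial>lborel)
      \<le> (\<integral>\<^sup>+ x. ennreal c * heat_kernel (2 * t) (x :: real ^ 'n) \<partial>lborel)"
    using norm_power_heat_kernel_le[OF assms] \<open>c \<ge> 0\<close>
    by (intro nn_integral_mono) (simp add: c_def heat_kernel_nonneg flip: ennreal_mult')
  also have "\<dots> = c"
    using assms by (simp add: nn_integral_cmult nn_integral_heat_kernel)
  finally show ?thesis
    by (simp add: c_def)
qed

section \<open>Convolution of a Borel kernel with a Lebesgue measurable function\<close>

lemma nn_integral_convolution_lebesgue:
  fixes h :: "'a::euclidean_space \<Rightarrow> real" and w :: "'a \<Rightarrow> real"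
  assumes [measurable]: "h \<in> borel_measurable borel" and w: "w \<in> borel_measurable lebesgue"
    and h_nonneg: "\<And>z. h z \<ge> 0"
  shows "(\<integral>\<^sup>+ x. (\<integral>\<^sup>+ y. h (x - y) * w y \<partial>lebesgue) \<partial>lebesgue)
    = (\<integral>\<^sup>+ z. h z \<partial>lborel) * (\<integral>\<^sup>+ y. w y \<partial>lebesgue)"
proof -
  \<comment> \<open>Tonelli is applied to \<open>lborel\<close>, where joint measurability calls for
    a Borel function. A Borel representative \<open>v\<close> of \<open>w\<close> leaves the inner
    integral unchanged for every \<open>x\<close>, since it differs from \<open>w\<close> only on a
    null set of \<open>y\<close>.\<close>
  obtain v where [measurable]: "v \<in> borel_measurable lborel" and wv: "AE y in lborel. w y = v y"
    using completion_ex_borel_measurable_real[OF w] by blast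
  have "(\<integral>\<^sup>+ x. (\<integral>\<^sup>+ y. h (x - y) * w y \<partial>lebesgue) \<partial>lebesgue)
      = (\<integral>\<^sup>+ x. (\<integral>\<^sup>+ y. h (x - y) * v y \<partial>lborel) \<partial>lborel)"
    unfolding nn_integral_completion using wv
    by (intro nn_integral_cong nn_integral_cong_AE) auto
  \<comment> \<open>The functions \<open>w\<close> and \<open>v\<close> carry no sign condition, and
    \<open>ennreal\<close> sends negative values to 0. Nonnegativity of \<open>h\<close> is what
    makes \<open>ennreal\<close> multiplicative here.\<close>
  also have "\<dots> = (\<integral>\<^sup>+ y. (\<integral>\<^sup>+ x. ennreal (h (x - y)) * ennreal (v y) \<partial>lborel) \<partial>lborel)"
    by (subst lborel_pair.Fubini') (simp_all add: ennreal_mult' h_nonneg)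
  also have "\<dots> = (\<integral>\<^sup>+ y. (\<integral>\<^sup>+ x. h (x - y) \<partial>lborel) * ennreal (v y) \<partial>lborel)"
    by (simp add: nn_integral_multc)
  \<comment> \<open>By translation invariance the integral over \<open>x\<close> does not depend on
    \<open>y\<close>.\<close>
  also have "\<dots> = (\<integral>\<^sup>+ y. (\<integral>\<^sup>+ z. h z \<partial>lborel) * ennreal (v y) \<partial>lborel)"
  proof -
    have "(\<integral>\<^sup>+ x. h (x - y) \<partial>lborel) = (\<integral>\<^sup>+ z. h z \<partial>lborel)" for y
      by (subst (2) lborel_distr_plus[of "- y", symmetric]) (simp add: nn_integral_distr)
    then show ?thesis by simp
  qed
  also have "(\<integral>\<^sup>+ y. (\<integral>\<^sup>+ z. h z \<partial>lborel) * ennreal (v y) \<partial>lborel)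
      = (\<integral>\<^sup>+ z. h z \<partial>lborel) * (\<integral>\<^sup>+ y. v y \<partial>lborel)"
    by (simp add: nn_integral_cmult)
  also have "(\<integral>\<^sup>+ y. v y \<partial>lborel) = (\<integral>\<^sup>+ y. w y \<partial>lebesgue)"
    unfolding nn_integral_completion using wv by (intro nn_integral_cong_AE) auto
  finally show ?thesis .
qed

text \<open>Allows the outer integral of a sum of two convolutions to be split. Passing to a Borel
  representative of \<open>w\<close> does not change the convolution at any point.\<close>

lemma borel_measurable_convolution_lebesgue:
  fixes h :: "'a::euclidean_space \<Rightarrow> real" and w :: "'a \<Rightarrow> real"
  assumes [measurable]: "h \<in> borel_measurable borel" and w: "w \<in> borel_measurable lebesgue"
  shows "(\<lambda>x. \<integral>\<^sup>+ y. h (x - y) * w y \<partial>lebesgue) \<in> borel_measurable lebesgue"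
proof -
  obtain v where [measurable]: "v \<in> borel_measurable lborel" and wv: "AE y in lborel. w y = v y"
    using completion_ex_borel_measurable_real[OF w] by blast
  have "(\<integral>\<^sup>+ y. h (x - y) * w y \<partial>lebesgue) = (\<integral>\<^sup>+ y. h (x - y) * v y \<partial>lborel)" for x
    unfolding nn_integral_completion using wv by (intro nn_integral_cong_AE) auto
  moreover have "(\<lambda>x. \<integral>\<^sup>+ y. h (x - y) * v y \<partial>lborel) \<in> borel_measurable lborel"
    by measurable
  ultimately show ?thesis
    by (simp add: measurable_completion)
qed

section \<open>The commutator for a single multi-index\<close>

lemma integrable_heat_kernel_scaleR:
  fixes \<phi> :: "real ^ 'n::finite \<Rightarrow> complex"
  assumes "t > 0" and \<phi>: "integrable lebesgue \<phi>"
  shows "integrable lebesgue (\<lambda>y. heat_kernel t (x - y) *\<^sub>R \<phi> y)"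
\<comment> \<open>The kernel is bounded by its value at the origin, so a constant multiple of
  \<open>\<phi>\<close> dominates the integrand.\<close>
proof (rule Bochner_Integration.integrable_bound)
  show "integrable lebesgue (\<lambda>y. (4 * pi * t) powr (- real CARD('n) / 2) *\<^sub>R \<phi> y)"
    using \<phi> by simp
  have "(\<lambda>y. heat_kernel t (x - y)) \<in> borel_measurable lebesgue"
    by (intro measurable_completion) simp
  then show "(\<lambda>y. heat_kernel t (x - y) *\<^sub>R \<phi> y) \<in> borel_measurable lebesgue"
    using \<phi> by (intro borel_measurable_scaleR) auto
  show "AE y in lebesgue. norm (heat_kernel t (x - y) *\<^sub>R \<phi> y)
      \<le> norm ((4 * pi * t) powr (- real CARD('n) / 2) *\<^sub>R \<phi> y)"
    using heat_kernel_le[OF \<open>t > 0\<close>, where 'n = 'n]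
    by (intro AE_I2) (simp add: heat_kernel_nonneg mult_right_mono)
qed

text \<open>Both integrability assumptions enter through linearity: the Bochner integral of a
  non-integrable function is 0 by convention, so the two heat integrals may be merged only once each
  is known to converge.\<close>

lemma norm_heat_semigroup_commutator_le:
  fixes \<phi> :: "real ^ 'n::finite \<Rightarrow> complex"
  assumes "t > 0" "integrable lebesgue \<phi>" "integrable lebesgue (\<lambda>y. mi_pow y \<alpha> *\<^sub>R \<phi> y)"
  shows "ennreal (norm (mi_pow x \<alpha> *\<^sub>R heat_semigroup t \<phi> x
      - heat_semigroup t (\<lambda>y. mi_pow y \<alpha> *\<^sub>R \<phi> y) x))
    \<le> (\<integral>\<^sup>+ y. \<bar>mi_pow x \<alpha> - mi_pow y \<alpha>\<bar> * heat_kernel t (x - y) * norm (\<phi> y) \<partial>lebesgue)"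
proof -
  let ?f = "\<lambda>y. mi_pow x \<alpha> *\<^sub>R (heat_kernel t (x - y) *\<^sub>R \<phi> y)
    - heat_kernel t (x - y) *\<^sub>R (mi_pow y \<alpha> *\<^sub>R \<phi> y)"
  note int = integrable_heat_kernel_scaleR[OF assms(1,2), of x]
    integrable_heat_kernel_scaleR[OF assms(1,3), of x]
  have "mi_pow x \<alpha> *\<^sub>R heat_semigroup t \<phi> x - heat_semigroup t (\<lambda>y. mi_pow y \<alpha> *\<^sub>R \<phi> y) x
      = (LINT y|lebesgue. ?f y)"
    unfolding heat_semigroup_def using int
    by (subst Bochner_Integration.integral_diff) (simp_all del: scaleR_scaleR)
  also have "ennreal (norm \<dots>) \<le> (\<integral>\<^sup>+ y. norm (?f y) \<partial>lebesgue)"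
    using int by (intro integral_norm_bound_ennreal Bochner_Integration.integrable_diff
        integrable_scaleR_right)
  also have "\<dots> = (\<integral>\<^sup>+ y. \<bar>mi_pow x \<alpha> - mi_pow y \<alpha>\<bar> * heat_kernel t (x - y) * norm (\<phi> y) \<partial>lebesgue)"
  proof (intro nn_integral_cong arg_cong[where f = ennreal])
    fix y
    have "?f y = ((mi_pow x \<alpha> - mi_pow y \<alpha>) * heat_kernel t (x - y)) *\<^sub>R \<phi> y"
      by (simp add: algebra_simps)
    then show "norm (?f y) = \<bar>mi_pow x \<alpha> - mi_pow y \<alpha>\<bar> * heat_kernel t (x - y) * norm (\<phi> y)"
      by (simp add: abs_mult heat_kernel_nonneg)
  qed
  finally show ?thesis .
qed

lemma L1_norm_heat_semigroup_commutator_le: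
  fixes \<phi> :: "real ^ 'n::finite \<Rightarrow> complex"
  assumes "m \<ge> 1" "t > 0" "\<phi> \<in> L1_weighted m" "mi_order \<alpha> = m"
  shows "L1_norm (\<lambda>x. mi_pow x \<alpha> *\<^sub>R heat_semigroup t \<phi> x
      - heat_semigroup t (\<lambda>y. mi_pow y \<alpha> *\<^sub>R \<phi> y) x)
    \<le> ennreal (real m * 2 ^ (m - 1) * ((8 * real m) ^ m * 2 powr (real CARD('n) / 2))) *
      (ennreal (sqrt t) * L1_norm (\<lambda>x. (norm x ^ (m - 1)) *\<^sub>R \<phi> x) + ennreal (sqrt t ^ m) * L1_norm \<phi>)"
proof -
  have int: "integrable lebesgue \<phi>" "integrable lebesgue (\<lambda>y. mi_pow y \<alpha> *\<^sub>R \<phi> y)"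
    using assms by (auto simp: L1_weighted_def)
  \<comment> \<open>\<open>A\<close> is the constant of the monomial estimate and \<open>B\<close>
    the moment constant for exponent \<open>m\<close>. The kernels \<open>h 1\<close> and
    \<open>h m\<close> match the two terms of that estimate and act on \<open>u\<close> and
    \<open>v\<close> respectively.\<close>
  define A :: real where "A = real m * 2 ^ (m - 1)"
  define B where "B = (8 * real m) ^ m * 2 powr (real CARD('n) / 2)"
  define h :: "nat \<Rightarrow> real ^ 'n \<Rightarrow> real" where "h k z = A * (norm z ^ k * heat_kernel t z)" for k z
  define u v :: "real ^ 'n \<Rightarrow> real"
    where "u y = norm ((norm y ^ (m - 1)) *\<^sub>R \<phi> y)" and "v y = norm (\<phi> y)" for y
  have "A \<ge> 0" "B \<ge> 0" by (simp_all add: A_def B_def)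
  have h_meas [measurable]: "h k \<in> borel_measurable borel" for k
    unfolding h_def[abs_def] by measurable
  have h_nonneg: "h k z \<ge> 0" for k z
    using \<open>A \<ge> 0\<close> by (simp add: h_def heat_kernel_nonneg)
  have h_leb: "(\<lambda>y. h k (x - y)) \<in> borel_measurable lebesgue" for k x
    by (intro measurable_completion) simp
  have v_meas: "v \<in> borel_measurable lebesgue"
    using int(1) unfolding v_def[abs_def] by auto
  have "(\<lambda>y::real ^ 'n. norm y ^ (m - 1)) \<in> borel_measurable lebesgue"
    by (intro measurable_completion) simp
  then have "(\<lambda>y. (norm y ^ (m - 1)) *\<^sub>R \<phi> y) \<in> borel_measurable lebesgue"
    using int(1) by (intro borel_measurable_scaleR) auto
  then have u_meas: "u \<in> borel_measurable lebesgue"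
    unfolding u_def[abs_def] by (rule measurable_compose) simp
  have h_int: "(\<integral>\<^sup>+ z. h k z \<partial>lborel) \<le> ennreal (A * (B * sqrt t ^ k))" if "1 \<le> k" "k \<le> m" for k
  proof -
    have "(\<integral>\<^sup>+ z. h k z \<partial>lborel) = A * (\<integral>\<^sup>+ z. norm z ^ k * heat_kernel t (z :: real ^ 'n) \<partial>lborel)"
      using \<open>A \<ge> 0\<close> by (simp add: h_def ennreal_mult' nn_integral_cmult)
    also have "\<dots> \<le> A * ennreal ((8 * real k) ^ k * 2 powr (real CARD('n) / 2) * sqrt t ^ k)"
      by (intro mult_left_mono nn_integral_norm_power_heat_kernel_le \<open>t > 0\<close>) simp
    \<comment> \<open>Monotonicity in base and exponent lets the single constant \<open>B\<close>
      serve both the first and the \<open>m\<close>-th moment; the base \<open>8 * m\<close> is at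
      least 1.\<close>
    also have "(8 * real k) ^ k \<le> (8 * real m) ^ m"
    proof -
      have "(8 * real k) ^ k \<le> (8 * real m) ^ k"
        using that by (intro power_mono) auto
      also have "\<dots> \<le> (8 * real m) ^ m"
        using that by (intro power_increasing) auto
      finally show ?thesis .
    qed
    then have "A * ennreal ((8 * real k) ^ k * 2 powr (real CARD('n) / 2) * sqrt t ^ k)
        \<le> A * ennreal (B * sqrt t ^ k)"
      unfolding B_def using \<open>t > 0\<close>
      by (intro mult_left_mono ennreal_leI mult_right_mono) auto
    finally show ?thesis
      using \<open>A \<ge> 0\<close> by (simp add: ennreal_mult')
  qed
  have "ennreal (norm (mi_pow x \<alpha> *\<^sub>R heat_semigroup t \<phi> x
      - heat_semigroup t (\<lambda>y. mi_pow y \<alpha> *\<^sub>R \<phi> y) x))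
    \<le> (\<integral>\<^sup>+ y. h 1 (x - y) * u y \<partial>lebesgue) + (\<integral>\<^sup>+ y. h m (x - y) * v y \<partial>lebesgue)" for x
  proof -
    have "ennreal (norm (mi_pow x \<alpha> *\<^sub>R heat_semigroup t \<phi> x
        - heat_semigroup t (\<lambda>y. mi_pow y \<alpha> *\<^sub>R \<phi> y) x))
      \<le> (\<integral>\<^sup>+ y. \<bar>mi_pow x \<alpha> - mi_pow y \<alpha>\<bar> * heat_kernel t (x - y) * norm (\<phi> y) \<partial>lebesgue)"
      by (rule norm_heat_semigroup_commutator_le[OF \<open>t > 0\<close> int])
    also have "\<dots> \<le> (\<integral>\<^sup>+ y. ennreal (h 1 (x - y) * u y) + ennreal (h m (x - y) * v y) \<partial>lebesgue)"
    proof (rule nn_integral_mono)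
      fix y
      have "\<bar>mi_pow x \<alpha> - mi_pow y \<alpha>\<bar> * heat_kernel t (x - y) * norm (\<phi> y)
        \<le> A * (norm (x - y) * norm y ^ (m - 1) + norm (x - y) ^ m) * heat_kernel t (x - y) * norm (\<phi> y)"
        unfolding A_def using assms
        by (intro mult_right_mono abs_mi_pow_diff_le heat_kernel_nonneg) auto
      also have "\<dots> = h 1 (x - y) * u y + h m (x - y) * v y"
        by (simp add: h_def u_def v_def algebra_simps)
      finally show "ennreal (\<bar>mi_pow x \<alpha> - mi_pow y \<alpha>\<bar> * heat_kernel t (x - y) * norm (\<phi> y))
        \<le> ennreal (h 1 (x - y) * u y) + ennreal (h m (x - y) * v y)"
        using h_nonneg by (simp add: u_def v_def flip: ennreal_plus)
    qed
    also have "\<dots> = (\<integral>\<^sup>+ y. h 1 (x - y) * u y \<partial>lebesgue) + (\<integral>\<^sup>+ y. h m (x - y) * v y \<partial>lebesgue)"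
      using h_leb u_meas v_meas by (intro nn_integral_add) auto
    finally show ?thesis .
  qed
  then have "L1_norm (\<lambda>x. mi_pow x \<alpha> *\<^sub>R heat_semigroup t \<phi> x
        - heat_semigroup t (\<lambda>y. mi_pow y \<alpha> *\<^sub>R \<phi> y) x)
      \<le> (\<integral>\<^sup>+ x. (\<integral>\<^sup>+ y. h 1 (x - y) * u y \<partial>lebesgue) + (\<integral>\<^sup>+ y. h m (x - y) * v y \<partial>lebesgue) \<partial>lebesgue)"
    unfolding L1_norm_def by (intro nn_integral_mono)
  also have "\<dots> = (\<integral>\<^sup>+ x. (\<integral>\<^sup>+ y. h 1 (x - y) * u y \<partial>lebesgue) \<partial>lebesgue)
      + (\<integral>\<^sup>+ x. (\<integral>\<^sup>+ y. h m (x - y) * v y \<partial>lebesgue) \<partial>lebesgue)"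
    using u_meas v_meas
    by (intro nn_integral_add borel_measurable_convolution_lebesgue h_meas)
  also have "\<dots> = (\<integral>\<^sup>+ z. h 1 z \<partial>lborel) * L1_norm (\<lambda>x. (norm x ^ (m - 1)) *\<^sub>R \<phi> x)
      + (\<integral>\<^sup>+ z. h m z \<partial>lborel) * L1_norm \<phi>"
    using u_meas v_meas h_nonneg
    by (simp add: nn_integral_convolution_lebesgue) (simp add: u_def v_def L1_norm_def)
  also have "\<dots> \<le> ennreal (A * (B * sqrt t ^ 1)) * L1_norm (\<lambda>x. (norm x ^ (m - 1)) *\<^sub>R \<phi> x)
      + ennreal (A * (B * sqrt t ^ m)) * L1_norm \<phi>"
    using \<open>m \<ge> 1\<close> by (intro add_mono mult_right_mono h_int) auto
  also have "\<dots> = ennreal (A * B) *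
      (ennreal (sqrt t) * L1_norm (\<lambda>x. (norm x ^ (m - 1)) *\<^sub>R \<phi> x) + ennreal (sqrt t ^ m) * L1_norm \<phi>)"
    using \<open>A \<ge> 0\<close> \<open>B \<ge> 0\<close> \<open>t > 0\<close> by (simp add: ennreal_mult' distrib_left mult.assoc)
  finally show ?thesis
    by (simp add: A_def B_def)
qed

section \<open>Summation over the multi-indices\<close>

theorem theorem2p9:
  fixes m :: nat
  assumes "m \<ge> 1"
  shows "\<exists>C::real. C > 0 \<and>
    (\<forall>\<phi> \<in> (L1_weighted m :: (real ^ 'n::finite \<Rightarrow> complex) set). \<forall>t::real. t > 0 \<longrightarrow>
      (\<Sum>\<alpha> | mi_order \<alpha> = m.
         L1_norm (\<lambda>x. mi_pow x \<alpha> *\<^sub>R heat_semigroup t \<phi> x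
                    - heat_semigroup t (\<lambda>y. mi_pow y \<alpha> *\<^sub>R \<phi> y) x))
      \<le> ennreal C *
          (ennreal (t powr (1 / 2)) * L1_norm (\<lambda>x. (norm x ^ (m - 1)) *\<^sub>R \<phi> x)
           + ennreal (t powr (1 / 2) + t powr (real m / 2)) * L1_norm \<phi>))"
proof -
  define K where "K = real m * 2 ^ (m - 1) * ((8 * real m) ^ m * 2 powr (real CARD('n) / 2))"
  define N where "N = card {\<alpha> :: 'n \<Rightarrow> nat. mi_order \<alpha> = m}"
  have "K > 0"
    using assms by (simp add: K_def)
  show ?thesis
  \<comment> \<open>Each of the \<open>N\<close> multi-indices contributes at most \<open>K\<close>
    times the bracket. Taking \<open>Suc N\<close> makes positivity of the constant
    immediate.\<close>
  proof (intro exI[of _ "real (Suc N) * K"] conjI ballI allI impI)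
    show "real (Suc N) * K > 0"
      using \<open>K > 0\<close> by simp
    fix \<phi> :: "real ^ 'n \<Rightarrow> complex" and t :: real
    assume \<phi>: "\<phi> \<in> L1_weighted m" and "t > 0"
    define E where "E = ennreal (t powr (1 / 2)) * L1_norm (\<lambda>x. (norm x ^ (m - 1)) *\<^sub>R \<phi> x)
      + ennreal (t powr (1 / 2) + t powr (real m / 2)) * L1_norm \<phi>"
    have powr: "sqrt t = t powr (1 / 2)" "sqrt t ^ m = t powr (real m / 2)"
      using \<open>t > 0\<close> by (simp_all add: powr_powr flip: powr_half_sqrt powr_realpow)
    have "L1_norm (\<lambda>x. mi_pow x \<alpha> *\<^sub>R heat_semigroup t \<phi> x
        - heat_semigroup t (\<lambda>y. mi_pow y \<alpha> *\<^sub>R \<phi> y) x) \<le> ennreal K * E" if "mi_order \<alpha> = m" for \<alpha>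
    proof -
      have "L1_norm (\<lambda>x. mi_pow x \<alpha> *\<^sub>R heat_semigroup t \<phi> x
          - heat_semigroup t (\<lambda>y. mi_pow y \<alpha> *\<^sub>R \<phi> y) x)
        \<le> ennreal K * (ennreal (t powr (1 / 2)) * L1_norm (\<lambda>x. (norm x ^ (m - 1)) *\<^sub>R \<phi> x)
          + ennreal (t powr (real m / 2)) * L1_norm \<phi>)"
        using L1_norm_heat_semigroup_commutator_le[OF assms \<open>t > 0\<close> \<phi> that]
        unfolding K_def powr(2) by (simp only: powr(1))
      \<comment> \<open>The coefficient of \<open>L1_norm \<phi>\<close> only grows, as
        \<open>t powr (1 / 2)\<close> is nonnegative.\<close>
      also have "\<dots> \<le> ennreal K * E"
        unfolding E_def by (intro mult_left_mono add_left_mono mult_right_mono ennreal_leI) auto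
      finally show ?thesis .
    qed
    then have "(\<Sum>\<alpha> | mi_order \<alpha> = m. L1_norm (\<lambda>x. mi_pow x \<alpha> *\<^sub>R heat_semigroup t \<phi> x
        - heat_semigroup t (\<lambda>y. mi_pow y \<alpha> *\<^sub>R \<phi> y) x)) \<le> of_nat N * (ennreal K * E)"
      unfolding N_def by (intro sum_bounded_above) auto
    also have "\<dots> \<le> of_nat (Suc N) * (ennreal K * E)"
      by (intro mult_right_mono) auto
    also have "\<dots> = ennreal (real (Suc N) * K) * E"
      by (simp only: ennreal_mult' of_nat_0_le_iff ennreal_of_nat_eq_real_of_nat mult.assoc)
    finally show "(\<Sum>\<alpha> | mi_order \<alpha> = m. L1_norm (\<lambda>x. mi_pow x \<alpha> *\<^sub>R heat_semigroup t \<phi> x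
        - heat_semigroup t (\<lambda>y. mi_pow y \<alpha> *\<^sub>R \<phi> y) x))
      \<le> ennreal (real (Suc N) * K) * (ennreal (t powr (1 / 2)) * L1_norm (\<lambda>x. (norm x ^ (m - 1)) *\<^sub>R \<phi> x)
        + ennreal (t powr (1 / 2) + t powr (real m / 2)) * L1_norm \<phi>)"
      unfolding E_def .
  qed
qed

end
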